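(* Let $n,p\ge 1$, let $X\in\mathbb{R}^{n\times p}$ satisfy $\mathrm{diag}(X^\top X)=nI_p$, let $\hat\Sigma=X^\top X/n$, and let $S\subseteq\{1,\dots,p\}$ be nonempty with $s=|S|$ and $S^c=\{1,\dots,p\}\setminus S$. Let $$\phi^2=\min\left\{\frac{s\,v^\top\hat\Sigma v}{\|v_S\|_1^2}\;:\; v\in\mathbb{R}^p,\ v\neq 0,\ \|v_{S^c}\|_1\le 3\|v_S\|_1\right\}.$$ For each sign vector $z=(z_j)_{j\in S}\in\{-1,1\}^S$, let $\phi_z^2$ be the optimal value of the optimization problem $$\begin{aligned}\min_{v\in\mathbb{R}^p,\;u\in\mathbb{R}^{S^c}}\quad & s\,v^\top\hat\Sigma v\\ \text{subject to}\quad & \sum_{j\in S}z_jv_j=1,\\ & z_jv_j\ge 0\quad(\forall j\in S),\\ & -u_j\le v_j\le u_j\quad(\forall j\in S^c),\\ & u_j\ge 0\quad(\forall j\in S^c),\\ & \sum_{j\in S^c}u_j\le 3.\end{aligned}$$ Then, for each fixed $z$, this problem is a convex quadratic program (all of its constraints are linear, so its feasible region is convex, and its objective function is a convex quadratic function), and $$\phi^2=\min_{z\in\{-1,1\}^S}\phi_z^2 .$$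
   Context: For $v\in\mathbb{R}^p$ and $A\subseteq\{1,\dots,p\}$, $v_A$ denotes the subvector $(v_j)_{j\in A}$ and $\|v_A\|_1=\sum_{j\in A}|v_j|$. The quantity $\phi\ge 0$ is called the compatibility constant of the design matrix $X$ with respect to the support $S$. Any feasible $v$ in its definition has $v_S\neq 0$, so the ratio is well defined. *)

theory Defs
  imports "HOL-Analysis.Analysis"
begin

definition l1_on :: "'p set \<Rightarrow> real ^ 'p \<Rightarrow> real" where
  "l1_on A v = (\<Sum>j\<in>A. \<bar>v $ j\<bar>)"

definition gram :: "real ^ 'p ^ 'n \<Rightarrow> real ^ 'p ^ 'p" where
  "gram X = (1 / real CARD('n)) *\<^sub>R (transpose X ** X)"

definition is_minimum :: "real set \<Rightarrow> real \<Rightarrow> bool" where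
  "is_minimum A m \<longleftrightarrow> m \<in> A \<and> (\<forall>x\<in>A. m \<le> x)"

definition compat_ratios :: "real ^ 'p ^ 'n \<Rightarrow> 'p set \<Rightarrow> real set" where
  "compat_ratios X S =
     {real (card S) * (v \<bullet> (gram X *v v)) / (l1_on S v)\<^sup>2 | v.
        v \<noteq> 0 \<and> l1_on (- S) v \<le> 3 * l1_on S v}"

text \<open>The compatibility constant is the nonnegative number whose square is the minimum of the
  ratios.  \<open>Least\<close> is unspecified when there is no minimum, so attainment has to be shown.\<close>

definition compat_const :: "real ^ 'p ^ 'n \<Rightarrow> 'p set \<Rightarrow> real" where
  "compat_const X S = sqrt (LEAST r. r \<in> compat_ratios X S)"

text \<open>An optimization problem is given by a subspace \<open>V\<close> of decision variables, a set \<open>C\<close> of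
  constraints (predicates), and an objective \<open>f\<close> that is to be minimized.\<close>

definition feasible_region :: "'a set \<Rightarrow> ('a \<Rightarrow> bool) set \<Rightarrow> 'a set" where
  "feasible_region V C = {x \<in> V. \<forall>c\<in>C. c x}"

definition optimal_value :: "'a set \<Rightarrow> ('a \<Rightarrow> bool) set \<Rightarrow> ('a \<Rightarrow> real) \<Rightarrow> real" where
  "optimal_value V C f = Inf (f ` feasible_region V C)"

definition linear_constraint :: "('a::euclidean_space \<Rightarrow> bool) \<Rightarrow> bool" where
  "linear_constraint c \<longleftrightarrow>
     (\<exists>g b. linear (g :: 'a \<Rightarrow> real) \<and> ((\<forall>x. c x \<longleftrightarrow> g x = b) \<or> (\<forall>x. c x \<longleftrightarrow> g x \<le> b)))"

definition quadratic_function :: "('a::euclidean_space \<Rightarrow> real) \<Rightarrow> bool" where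
  "quadratic_function f \<longleftrightarrow>
     (\<exists>B g c. bilinear (B :: 'a \<Rightarrow> 'a \<Rightarrow> real) \<and> linear (g :: 'a \<Rightarrow> real) \<and>
              (\<forall>x. f x = B x x + g x + c))"

definition convex_quadratic_program ::
    "'a::euclidean_space set \<Rightarrow> ('a \<Rightarrow> bool) set \<Rightarrow> ('a \<Rightarrow> real) \<Rightarrow> bool" where
  "convex_quadratic_program V C f \<longleftrightarrow>
     subspace V \<and> finite C \<and> (\<forall>c\<in>C. linear_constraint c) \<and>
     quadratic_function f \<and> convex_on V f"

definition sign_vectors :: "'p set \<Rightarrow> ('p \<Rightarrow> real) set" where
  "sign_vectors S = S \<rightarrow>\<^sub>E {-1, 1}"

text \<open>A vector \<open>u\<close> indexed by the complement of \<open>S\<close> is encoded as a vector over the full index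
  set whose coordinates in \<open>S\<close> vanish.\<close>

definition qp_space :: "'p set \<Rightarrow> ((real ^ 'p) \<times> (real ^ 'p)) set" where
  "qp_space S = {(v, u). \<forall>j\<in>S. u $ j = 0}"

definition qp_constraints ::
    "'p set \<Rightarrow> ('p \<Rightarrow> real) \<Rightarrow> ((real ^ 'p) \<times> (real ^ 'p) \<Rightarrow> bool) set" where
  "qp_constraints S z =
     {\<lambda>(v, u). (\<Sum>j\<in>S. z j * v $ j) = 1}
     \<union> (\<lambda>j (v, u). z j * v $ j \<ge> 0) ` S
     \<union> (\<lambda>j (v, u). - u $ j \<le> v $ j) ` (- S)
     \<union> (\<lambda>j (v, u). v $ j \<le> u $ j) ` (- S)
     \<union> (\<lambda>j (v, u). u $ j \<ge> 0) ` (- S)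
     \<union> {\<lambda>(v, u). (\<Sum>j\<in>- S. u $ j) \<le> 3}"

definition qp_objective :: "real ^ 'p ^ 'n \<Rightarrow> 'p set \<Rightarrow> (real ^ 'p) \<times> (real ^ 'p) \<Rightarrow> real" where
  "qp_objective X S = (\<lambda>(v, u). real (card S) * (v \<bullet> (gram X *v v)))"

definition qp_value :: "real ^ 'p ^ 'n \<Rightarrow> 'p set \<Rightarrow> ('p \<Rightarrow> real) \<Rightarrow> real" where
  "qp_value X S z = optimal_value (qp_space S) (qp_constraints S z) (qp_objective X S)"

end

theory Submission
  imports Defs
begin

text \<open>The ratio is invariant under scaling of \<open>v\<close>, so \<open>v\<close> may be normalized to have
  \<open>\<ell>\<^sub>1\<close>-norm 1 on \<open>S\<close>; taking \<open>z\<close> to be its sign pattern and \<open>u\<close> its absolute value off \<open>S\<close>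
  then gives a feasible point of the program for \<open>z\<close> with the ratio as objective value.
  Conversely every feasible \<open>v\<close> has \<open>\<ell>\<^sub>1\<close>-norm 1 on \<open>S\<close> and at most 3 off \<open>S\<close>.  Thus the set of
  ratios is exactly the union over \<open>z\<close> of the sets of objective values, and each of those has a
  minimum because the feasible region is compact.\<close>

section \<open>Linear constraints and the feasible region\<close>

lemma linear_constraint_convex:
  assumes "linear_constraint c"
  shows "convex {x. c x}"
proof -
  obtain g :: "'a \<Rightarrow> real" and b where g: "linear g"
    \<comment> \<open>A solution set is the preimage of a point or a half-line under a linear
      functional; both targets are convex and closed.\<close>
    and c: "{x. c x} = g -` {b} \<or> {x. c x} = g -` {..b}"
    using assms unfolding linear_constraint_def by (auto simp: vimage_def)
  then show ?thesis
    by (auto intro!: convex_linear_vimage)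
qed

lemma linear_constraint_closed:
  assumes "linear_constraint c"
  shows "closed {x. c x}"
proof -
  obtain g :: "'a \<Rightarrow> real" and b where g: "linear g"
    and c: "{x. c x} = g -` {b} \<or> {x. c x} = g -` {..b}"
    using assms unfolding linear_constraint_def by (auto simp: vimage_def)
  then show ?thesis
    by (auto intro!: continuous_closed_vimage linear_continuous_at simp: linear_conv_bounded_linear)
qed

text \<open>In this form the region inherits convexity and closedness from \<open>V\<close> and from
  each single constraint.\<close>

lemma feasible_region_eq_Inter:
  "feasible_region V C = V \<inter> (\<Inter>c\<in>C. {x. c x})"
  by (auto simp: feasible_region_def)

lemma linear_constraint_eq:
  fixes g :: "'a::euclidean_space \<Rightarrow> real"
  shows "linear g \<Longrightarrow> linear_constraint (\<lambda>x. g x = b)"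
  unfolding linear_constraint_def by (intro exI[of _ g] exI[of _ b]) simp

lemma linear_constraint_le:
  fixes g h :: "'a::euclidean_space \<Rightarrow> real"
  assumes "linear g" "linear h"
  shows "linear_constraint (\<lambda>x. g x \<le> h x + b)"
proof -
  have "linear (\<lambda>x. g x - h x)"
    using assms by (rule linear_compose_sub)
  moreover have "\<forall>x. g x \<le> h x + b \<longleftrightarrow> g x - h x \<le> b" by (simp add: diff_le_eq add.commute)
  ultimately show ?thesis unfolding linear_constraint_def by blast
qed

lemma linear_fst_nth: "linear (\<lambda>x :: (real^'p) \<times> (real^'p). fst x $ j)"
  and linear_snd_nth: "linear (\<lambda>x :: (real^'p) \<times> (real^'p). snd x $ j)"
  by (auto intro!: linearI)

lemma qp_constraints_linear:
  fixes S :: "'p::finite set"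
  assumes "c \<in> qp_constraints S z"
  shows "linear_constraint c"
proof -
  note lin = linear_fst_nth linear_snd_nth linear_compose_sum linear_compose_neg
    linear_compose_scale_right[where 'b = real, simplified] linear_zero
  have "linear_constraint (\<lambda>x :: (real^'p) \<times> (real^'p). (\<Sum>j\<in>S. z j * fst x $ j) = 1)"
    by (intro linear_constraint_eq lin ballI)
  \<comment> \<open>The summands \<open>+ 0\<close> here, and \<open>0 + 3\<close> below, give each
    inequality the shape \<open>g x \<le> h x + b\<close> of \<open>linear_constraint_le\<close>;
    the final unfolding removes them.\<close>
  moreover have "linear_constraint (\<lambda>x :: (real^'p) \<times> (real^'p). 0 \<le> z j * fst x $ j + 0)" for j
    by (intro linear_constraint_le lin)
  moreover have "linear_constraint (\<lambda>x :: (real^'p) \<times> (real^'p). - snd x $ j \<le> fst x $ j + 0)" for j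
    by (intro linear_constraint_le lin)
  moreover have "linear_constraint (\<lambda>x :: (real^'p) \<times> (real^'p). fst x $ j \<le> snd x $ j + 0)" for j
    by (intro linear_constraint_le lin)
  moreover have "linear_constraint (\<lambda>x :: (real^'p) \<times> (real^'p). 0 \<le> snd x $ j + 0)" for j
    by (intro linear_constraint_le lin)
  moreover have "linear_constraint (\<lambda>x :: (real^'p) \<times> (real^'p). (\<Sum>j\<in>- S. snd x $ j) \<le> 0 + 3)"
    by (intro linear_constraint_le lin ballI)
  ultimately show ?thesis
    using assms unfolding qp_constraints_def case_prod_unfold add_0_left add_0_right by blast
qed

text \<open>Working form of membership: off \<open>S\<close>, the sandwich of \<open>v $ j\<close>
  and the sign of \<open>u $ j\<close> merge into one absolute-value bound.\<close>

lemma mem_qp_region: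
  "(v, u) \<in> feasible_region (qp_space S) (qp_constraints S z) \<longleftrightarrow>
     (\<forall>j\<in>S. u $ j = 0) \<and> (\<Sum>j\<in>S. z j * v $ j) = 1 \<and> (\<forall>j\<in>S. 0 \<le> z j * v $ j) \<and>
     (\<forall>j\<in>- S. \<bar>v $ j\<bar> \<le> u $ j) \<and> (\<Sum>j\<in>- S. u $ j) \<le> 3"
proof -
  have "(\<forall>j\<in>- S. \<bar>v $ j\<bar> \<le> u $ j) \<longleftrightarrow>
      (\<forall>j\<in>- S. - u $ j \<le> v $ j) \<and> (\<forall>j\<in>- S. v $ j \<le> u $ j) \<and> (\<forall>j\<in>- S. 0 \<le> u $ j)"
    by (smt (verit))
  then show ?thesis
    unfolding feasible_region_def qp_space_def qp_constraints_def
    by (simp add: ball_Un conj_ac del: Compl_iff)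
qed

lemma qp_space_subspace: "subspace (qp_space S)"
  by (auto simp: subspace_def qp_space_def zero_prod_def)

section \<open>The objective as a convex quadratic function\<close>

lemma gram_quadratic_form:
  fixes X :: "real ^ 'p ^ 'n"
  shows "v \<bullet> (gram X *v w) = (X *v v) \<bullet> (X *v w) / real CARD('n)"
  by (simp add: gram_def scaleR_matrix_vector_assoc[symmetric] matrix_vector_mul_assoc[symmetric]
      inner_commute[of v] dot_lmul_matrix inner_commute[of "X *v v"])

text \<open>Moving \<open>transpose X\<close> across the inner product leaves a squared norm, from
  which nonnegativity, convexity and continuity are read off.\<close>

lemma qp_objective_eq:
  fixes X :: "real ^ 'p ^ 'n"
  shows "qp_objective X S x = real (card S) / real CARD('n) * (norm (X *v fst x))\<^sup>2"
  by (simp add: qp_objective_def case_prod_beta gram_quadratic_form power2_norm_eq_inner)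

lemma qp_objective_nonneg: "0 \<le> qp_objective X S x"
  by (simp add: qp_objective_eq)

lemma qp_objective_quadratic:
  fixes X :: "real ^ 'p ^ 'n"
  shows "quadratic_function (qp_objective X S)"
proof -
  \<comment> \<open>The polar form of the objective: its diagonal is the objective, so the linear
    and constant parts are 0.\<close>
  define B :: "(real^'p) \<times> (real^'p) \<Rightarrow> (real^'p) \<times> (real^'p) \<Rightarrow> real"
    where "B x y = real (card S) / real CARD('n) * ((X *v fst x) \<bullet> (X *v fst y))" for x y
  have "bilinear B"
    unfolding bilinear_def B_def
    by (auto intro!: linearI simp: matrix_vector_right_distrib matrix_vector_mult_scaleR
        inner_add_left inner_add_right distrib_left add_divide_distrib)
  moreover have "\<forall>x. qp_objective X S x = B x x + 0 + 0"
    by (simp add: qp_objective_eq B_def power2_norm_eq_inner)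
  ultimately show ?thesis
    unfolding quadratic_function_def using linear_zero by blast
qed

lemma qp_objective_convex:
  fixes X :: "real ^ 'p ^ 'n"
  assumes "convex V"
  shows "convex_on V (qp_objective X S)"
proof (rule convex_onI)
  fix t :: real and x y :: "(real^'p) \<times> (real^'p)"
  assume t: "0 < t" "t < 1"
  define k a b where "k = real (card S) / real CARD('n)" and "a = X *v fst x" and "b = X *v fst y"
  \<comment> \<open>The convexity gap of the squared norm is computed exactly; it is a nonnegative
    multiple of a square.\<close>
  have "(1 - t) * (norm a)\<^sup>2 + t * (norm b)\<^sup>2 - (norm ((1 - t) *\<^sub>R a + t *\<^sub>R b))\<^sup>2
      = t * (1 - t) * (norm (a - b))\<^sup>2"
    unfolding power2_norm_eq_inner
    by (simp add: inner_add_left inner_add_right inner_diff_left inner_diff_right inner_commute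
        algebra_simps)
  then have "(norm ((1 - t) *\<^sub>R a + t *\<^sub>R b))\<^sup>2 \<le> (1 - t) * (norm a)\<^sup>2 + t * (norm b)\<^sup>2"
    using t by (smt (verit) mult_nonneg_nonneg zero_le_power2)
  then have "k * (norm ((1 - t) *\<^sub>R a + t *\<^sub>R b))\<^sup>2
      \<le> k * ((1 - t) * (norm a)\<^sup>2 + t * (norm b)\<^sup>2)"
    by (intro mult_left_mono) (auto simp: k_def)
  then show "qp_objective X S ((1 - t) *\<^sub>R x + t *\<^sub>R y)
      \<le> (1 - t) * qp_objective X S x + t * qp_objective X S y"
    unfolding qp_objective_eq k_def[symmetric]
    by (simp add: matrix_vector_right_distrib matrix_vector_mult_scaleR a_def b_def algebra_simps)
qed (use assms in auto)

lemma qp_objective_continuous: "continuous_on A (qp_objective X S)"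
  unfolding qp_objective_eq[abs_def]
  by (intro continuous_intros
      bounded_linear.continuous_on[OF matrix_vector_mul_bounded_linear])

section \<open>Norm bounds and compactness of the feasible region\<close>

lemma sign_vector_abs:
  assumes "z \<in> sign_vectors S" "j \<in> S"
  shows "\<bar>z j\<bar> = 1"
  using assms by (auto simp: sign_vectors_def PiE_iff)

text \<open>A nonnegative \<open>z j * v $ j\<close> with \<open>\<bar>z j\<bar> = 1\<close> equals
  \<open>\<bar>v $ j\<bar>\<close>, so the linear normalization fixes the norm on \<open>S\<close>;
  off \<open>S\<close>, \<open>u\<close> dominates \<open>\<bar>v $ j\<bar>\<close>.\<close>

lemma qp_region_l1:
  assumes z: "z \<in> sign_vectors S"
    and x: "(v, u) \<in> feasible_region (qp_space S) (qp_constraints S z)"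
  shows "l1_on S v = 1" "l1_on (- S) v \<le> 3"
proof -
  have "l1_on S v = (\<Sum>j\<in>S. z j * v $ j)"
    unfolding l1_on_def
  proof (rule sum.cong)
    fix j assume "j \<in> S"
    then have "\<bar>z j * v $ j\<bar> = z j * v $ j" "\<bar>z j\<bar> = 1"
      using x z by (auto simp: mem_qp_region sign_vector_abs)
    then show "\<bar>v $ j\<bar> = z j * v $ j" by (simp add: abs_mult)
  qed simp
  then show "l1_on S v = 1" using x by (simp add: mem_qp_region)
  have "l1_on (- S) v \<le> (\<Sum>j\<in>- S. u $ j)"
    unfolding l1_on_def using x by (intro sum_mono) (auto simp: mem_qp_region)
  then show "l1_on (- S) v \<le> 3" using x by (simp add: mem_qp_region)
qed

lemma qp_region_compact:
  fixes S :: "'p::finite set"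
  assumes z: "z \<in> sign_vectors S"
  shows "compact (feasible_region (qp_space S) (qp_constraints S z))" (is "compact ?F")
proof -
  have "closed ?F"
    unfolding feasible_region_eq_Inter
    by (intro closed_Int closed_INT closed_subspace qp_space_subspace ballI
        linear_constraint_closed qp_constraints_linear)
  moreover have "bounded ?F"
  proof (rule boundedI)
    fix x assume "x \<in> ?F"
    then obtain v u where x: "x = (v, u)" "(v, u) \<in> ?F" by (cases x) auto
    have "norm v \<le> (\<Sum>j\<in>UNIV. \<bar>v $ j\<bar>)" by (rule norm_le_l1_cart)
    also have "\<dots> = l1_on S v + l1_on (- S) v"
      unfolding l1_on_def Compl_eq_Diff_UNIV by (simp add: sum.subset_diff[of S UNIV])
    finally have v: "norm v \<le> 4" using qp_region_l1[OF z x(2)] by simp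
    have "norm u \<le> (\<Sum>j\<in>UNIV. \<bar>u $ j\<bar>)" by (rule norm_le_l1_cart)
    \<comment> \<open>The encoding in \<open>qp_space\<close> matters here: coordinates of
      \<open>u\<close> in \<open>S\<close> are 0 and cannot run off to infinity.\<close>
    also have "\<dots> = (\<Sum>j\<in>- S. u $ j)"
      using x(2) by (intro sum.mono_neutral_cong_right) (force simp: mem_qp_region)+
    finally have "norm u \<le> 3" using x(2) by (simp add: mem_qp_region)
    then show "norm x \<le> 7" using v norm_Pair_le[of v u] x by simp
  qed
  ultimately show ?thesis by (simp add: compact_eq_bounded_closed)
qed

section \<open>The ratios as objective values\<close>

lemma compat_ratios_eq:
  fixes X :: "real ^ 'p ^ 'n"
  shows "compat_ratios X S =
    (\<Union>z\<in>sign_vectors S. qp_objective X S ` feasible_region (qp_space S) (qp_constraints S z))"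
    (is "_ = ?R")
proof (intro equalityI subsetI)
  fix r assume "r \<in> compat_ratios X S"
  then obtain v where v: "v \<noteq> 0" "l1_on (- S) v \<le> 3 * l1_on S v"
    and r: "r = real (card S) * (v \<bullet> (gram X *v v)) / (l1_on S v)\<^sup>2"
    by (auto simp: compat_ratios_def)
  have nn: "0 \<le> l1_on A v" for A by (simp add: l1_on_def sum_nonneg)
  \<comment> \<open>If \<open>v\<close> vanished on \<open>S\<close>, the cone condition would make
    it vanish off \<open>S\<close> too.\<close>
  have pos: "0 < l1_on S v"
  proof (rule ccontr)
    assume "\<not> 0 < l1_on S v"
    then have "l1_on S v = 0" "l1_on (- S) v = 0"
      using nn[of S] nn[of "- S"] v by auto
    then have "v $ j = 0" for j
      by (cases "j \<in> S") (auto simp: l1_on_def sum_nonneg_eq_0_iff)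
    then show False using v by (simp add: vec_eq_iff)
  qed
  define l where "l = l1_on S v"
  define w where "w = (1 / l) *\<^sub>R v"
  \<comment> \<open>\<open>u\<close> is the least vector dominating \<open>w\<close> off
    \<open>S\<close>, so its sum is the norm of \<open>w\<close> there. In \<open>z\<close>, zero
    coordinates get sign 1, and \<open>restrict\<close> makes it extensional as
    \<open>sign_vectors\<close> demands.\<close>
  define u :: "real^'p" where "u = (\<chi> j. if j \<in> S then 0 else \<bar>w $ j\<bar>)"
  define z where "z = restrict (\<lambda>j. if 0 \<le> v $ j then 1 else - 1 :: real) S"
  have l: "0 < l" using pos by (simp add: l_def)
  have z: "z \<in> sign_vectors S" by (auto simp: z_def sign_vectors_def)
  have zw: "z j * w $ j = \<bar>v $ j\<bar> / l" if "j \<in> S" for j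
    using that by (auto simp: z_def w_def)
  have "(\<Sum>j\<in>S. z j * w $ j) = l / l"
    by (simp add: zw l_def l1_on_def flip: sum_divide_distrib)
  moreover have "(\<Sum>j\<in>- S. u $ j) = l1_on (- S) v / l"
    using l by (auto simp: u_def w_def l1_on_def sum_divide_distrib abs_mult intro!: sum.cong)
  ultimately have "(w, u) \<in> feasible_region (qp_space S) (qp_constraints S z)"
    using l v by (auto simp: mem_qp_region zw u_def l_def pos_divide_le_eq)
  \<comment> \<open>The quadratic form is homogeneous of degree 2, so scaling by
    \<open>1 / l\<close> produces the denominator of the ratio.\<close>
  moreover have "qp_objective X S (w, u) = r"
    by (simp add: qp_objective_def r w_def matrix_vector_mult_scaleR l_def power2_eq_square)
  ultimately show "r \<in> ?R" using z by blast
next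
  fix r assume "r \<in> ?R"
  then obtain z v u where z: "z \<in> sign_vectors S"
    and x: "(v, u) \<in> feasible_region (qp_space S) (qp_constraints S z)"
    and r: "r = qp_objective X S (v, u)" by force
  note l = qp_region_l1[OF z x]
  \<comment> \<open>Norm 1 on \<open>S\<close> excludes \<open>v = 0\<close>, makes the denominator
    1 and turns the bound 3 into the cone condition.\<close>
  have "v \<noteq> 0" using l(1) by (auto simp: l1_on_def)
  moreover have "r = real (card S) * (v \<bullet> (gram X *v v)) / (l1_on S v)\<^sup>2"
    using l by (simp add: r qp_objective_def)
  ultimately show "r \<in> compat_ratios X S" using l by (auto simp only: compat_ratios_def mem_Collect_eq intro!: exI[of _ v])
qed

section \<open>Attainment and the minimum over sign vectors\<close>

lemma qp_region_nonempty:
  fixes S :: "'p::finite set"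
  assumes z: "z \<in> sign_vectors S" and S: "S \<noteq> {}"
  shows "feasible_region (qp_space S) (qp_constraints S z) \<noteq> {}"
proof -
  \<comment> \<open>Total mass 1 is spread evenly over \<open>S\<close> with the signs of
    \<open>z\<close>.\<close>
  define v :: "real^'p" where "v = (\<chi> j. if j \<in> S then z j / real (card S) else 0)"
  have "z j * v $ j = 1 / real (card S)" if "j \<in> S" for j
    using that z by (auto simp: v_def sign_vectors_def PiE_iff)
  then have "(v, 0) \<in> feasible_region (qp_space S) (qp_constraints S z)"
    using S by (auto simp: mem_qp_region) (simp add: v_def)
  then show ?thesis by blast
qed

lemma is_minimum_Inf: "is_minimum A m \<Longrightarrow> Inf A = m"
  unfolding is_minimum_def by (intro cInf_eq_minimum) auto

text \<open>By the extreme value theorem the \<open>Inf\<close> behind \<open>qp_value\<close> is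
  attained.\<close>

lemma qp_value_is_minimum:
  fixes X :: "real ^ 'p ^ 'n"
  assumes "z \<in> sign_vectors S" "S \<noteq> {}"
  shows "is_minimum (qp_objective X S ` feasible_region (qp_space S) (qp_constraints S z))
    (qp_value X S z)"
proof -
  obtain m where "is_minimum (qp_objective X S ` feasible_region (qp_space S) (qp_constraints S z)) m"
    using continuous_attains_inf[OF qp_region_compact[OF assms(1)] qp_region_nonempty[OF assms]
        qp_objective_continuous[of _ X S]]
    unfolding is_minimum_def by blast
  then show ?thesis
    using is_minimum_Inf unfolding qp_value_def optimal_value_def by metis
qed

lemma sign_vectors_finite: "finite (sign_vectors (S :: 'p::finite set))"
  unfolding sign_vectors_def by (intro finite_PiE) auto

lemma sign_vectors_nonempty: "sign_vectors S \<noteq> {}"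
  unfolding sign_vectors_def by (simp add: PiE_eq_empty_iff)

text \<open>Minimizing over a finite union in two stages; applied to
  \<open>compat_ratios_eq\<close>, this yields the formula for the compatibility constant.\<close>

lemma is_minimum_UN:
  assumes "finite I" "I \<noteq> {}" "\<And>i. i \<in> I \<Longrightarrow> is_minimum (A i) (m i)"
  shows "is_minimum (\<Union>i\<in>I. A i) (Min (m ` I))"
  unfolding is_minimum_def
proof (intro conjI ballI)
  have "Min (m ` I) \<in> m ` I" using assms by (intro Min_in) auto
  then show "Min (m ` I) \<in> (\<Union>i\<in>I. A i)" using assms(3) by (fastforce simp: is_minimum_def)
next
  fix x assume "x \<in> (\<Union>i\<in>I. A i)"
  then obtain i where i: "i \<in> I" "x \<in> A i" by blast
  then have "Min (m ` I) \<le> m i" using assms(1) by simp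
  also have "m i \<le> x" using assms(3) i by (auto simp: is_minimum_def)
  finally show "Min (m ` I) \<le> x" .
qed

theorem mainTheorem1:
  fixes X :: "real ^ 'p ^ 'n" and S :: "'p set"
  assumes "\<forall>j. (transpose X ** X) $ j $ j = real CARD('n)"
    and "S \<noteq> {}"
  shows "is_minimum (compat_ratios X S) ((compat_const X S)\<^sup>2)
    \<and> (\<forall>z \<in> sign_vectors S.
         convex_quadratic_program (qp_space S) (qp_constraints S z) (qp_objective X S)
         \<and> convex (feasible_region (qp_space S) (qp_constraints S z))
         \<and> is_minimum (qp_objective X S ` feasible_region (qp_space S) (qp_constraints S z))
             (qp_value X S z))
    \<and> (compat_const X S)\<^sup>2 = Min (qp_value X S ` sign_vectors S)"
proof -
  define m where "m = Min (qp_value X S ` sign_vectors S)"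
  have m: "is_minimum (compat_ratios X S) m"
    unfolding compat_ratios_eq m_def
    by (intro is_minimum_UN sign_vectors_finite sign_vectors_nonempty qp_value_is_minimum assms(2))
  then have "(LEAST r. r \<in> compat_ratios X S) = m"
    unfolding is_minimum_def by (intro Least_equality) auto
  \<comment> \<open>Nonnegativity lets squaring undo the \<open>sqrt\<close> in
    \<open>compat_const\<close>.\<close>
  moreover have "0 \<le> m"
    using m by (auto simp: is_minimum_def compat_ratios_eq qp_objective_nonneg)
  ultimately have phi: "(compat_const X S)\<^sup>2 = m"
    by (simp add: compat_const_def)
  have "finite (qp_constraints S z)" for z
    unfolding qp_constraints_def by simp
  then have "convex_quadratic_program (qp_space S) (qp_constraints S z) (qp_objective X S)" for z
    unfolding convex_quadratic_program_def
    by (simp add: qp_space_subspace qp_constraints_linear qp_objective_quadratic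
        qp_objective_convex subspace_imp_convex)
  moreover have "convex (feasible_region (qp_space S) (qp_constraints S z))" for z
    unfolding feasible_region_eq_Inter
    by (intro convex_Int convex_INT subspace_imp_convex qp_space_subspace
        linear_constraint_convex qp_constraints_linear)
  ultimately show ?thesis
    using m phi by (simp add: m_def qp_value_is_minimum[OF _ assms(2)])
qed

end
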